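(* Let $p\in\mathbb{Z}[X]$ be a polynomial of degree $1$ with strictly positive leading coefficient which is irreducible in $\mathbb{Z}[X]$. Then the rational fraction $4/p$ is $3$-Egyptian if and only if at least one of the following seven conditions holds, where in each condition the letters $A,B,C,D,E,F$ that occur denote strictly positive integers (constants): (1a) there exist $B,C,D$ with $\gcd(B,C)=1$ such that $B+pC\equiv 0 \pmod{4BCD-1}$; (1b) there exist $A,B,E$ with $\gcd(A,B)=1$ and $\gcd(4AB,E)=1$ such that $p+E\equiv 0\pmod{4AB}$ and $A+B\equiv 0\pmod{E}$; (1c) there exist $B,D,E$ with $\gcd(4BD,E)=1$ such that $p+E+4B^2D\equiv 0\pmod{4BDE}$; (2a) there exist $A,B,E$ with $\gcd(A,B)=1$ and $\gcd(4AB,E)=1$ such that $pE+1\equiv 0\pmod{4AB}$ and $A+B\equiv 0\pmod{E}$; (2b) there exist $B,C,F$ with $\gcd(B,C)=1$ and $\gcd(4BC,F)=1$ such that $p+F\equiv 0\pmod{4BC}$ and $pB+C\equiv 0\pmod{F}$; (2c) there exist $B,D,F$ with $\gcd(4BD,F)=1$ such that $p+F\equiv 0\pmod{4BD}$ and $4B^2D+1\equiv 0\pmod{F}$; (2d) there exist $C,D,F$ with $\gcd(4CD,F)=1$ such that $p+F\equiv 0\pmod{4CD}$ and $p^2+4C^2D\equiv 0\pmod{F}$.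
   Context: Let $\mathcal{A}_+$ be the set of polynomials in $\mathbb{Z}[X]$ whose leading coefficient is strictly positive (strictly positive integer constants are included). A rational fraction is called $3$-Egyptian if it is a sum of at most three inverses $1/Q$ of polynomials $Q\in\mathcal{A}_+$. For a polynomial $Q\in\mathbb{Z}[X]$ and an integer $m\ge 1$, $Q\equiv 0\pmod m$ means that $Q\in m\,\mathbb{Z}[X]$, i.e. every coefficient of $Q$ is divisible by $m$. *)

theory Defs
  imports "HOL-Computational_Algebra.Computational_Algebra"
begin

definition A_plus :: "int poly set" where
  "A_plus = {Q. lead_coeff Q > 0}"

text \<open>
  Rational fractions are elements of the fraction field of \<open>\<int>[X]\<close>, which is \<open>\<rat>(X)\<close>.
  The summands need not be distinct, hence a list rather than a set.
\<close>

definition egyptian :: "nat \<Rightarrow> int poly fract \<Rightarrow> bool" where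
  "egyptian n f \<longleftrightarrow>
     (\<exists>Qs. length Qs \<le> n \<and> set Qs \<subseteq> A_plus \<and> f = (\<Sum>Q\<leftarrow>Qs. 1 / to_fract Q))"

text \<open>Membership of \<open>Q\<close> in \<open>m\<int>[X]\<close>; integers occurring in \<open>Q\<close> are written as constant polynomials.\<close>

definition cong_zero :: "int poly \<Rightarrow> int \<Rightarrow> bool" where
  "cong_zero Q m \<longleftrightarrow> (\<exists>R. Q = smult m R)"

end

theory Submission
  imports Defs
begin

text \<open>
  The polynomial \<open>p\<close> is a prime of the factorial ring \<open>\<int>[X]\<close>, and \<open>4 / p = 1 / x + 1 / y + 1 / z\<close>
  forces it to divide one or two of the denominators. If it divides two, the solution has the form
  \<open>4 / p = 1 / (A B D) + 1 / (p m A D) + 1 / (p m B D)\<close> with coprime \<open>A\<close> and \<open>B\<close>, where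
  \<open>p + E = 4 A B D\<close> and \<open>m E = A + B\<close>; if it divides only one, it has the form
  \<open>4 / p = 1 / (p A B D) + 1 / (m A D) + 1 / (m B D)\<close>, where \<open>p E + 1 = 4 A B D\<close> and \<open>m E = A + B\<close>.
  As \<open>p\<close> is linear, comparing degrees makes all but a few of these parameters constant, and
  the remaining cases are exactly the seven conditions. The one further case that the degrees allow
  would factor \<open>p\<^sup>2 + 4 C\<^sup>2 D\<close>, which has no real root, into two linear polynomials.

  Throughout, membership in \<^const>\<open>A_plus\<close> is expressed by \<open>0 < Q\<close> in the ordered ring \<open>\<int>[X]\<close>,
  where polynomials are compared by the sign of the leading coefficient of their difference.
\<close>

section \<open>The order on \<int>[X] and constant polynomials\<close>

lemma lead_coeff_pos_iff: "lead_coeff q > 0 \<longleftrightarrow> 0 < (q :: int poly)"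
  by (cases "q = 0") (auto simp: less_poly_def pos_poly_def last_coeffs_eq_coeff_degree)

lemma const_poly_pos_iff [simp]: "0 < [:c:] \<longleftrightarrow> 0 < (c :: int)"
  by (simp flip: lead_coeff_pos_iff)

text \<open>For constants this is the discreteness of the integers; in positive degree, subtracting
  1 does not change the leading coefficient.\<close>

lemma one_le_pos_poly:
  fixes q :: "int poly"
  assumes "0 < q" shows "1 \<le> q"
proof (cases "degree q = 0")
  case True
  then obtain c where q: "q = [:c:]" by (rule degree_eq_zeroE)
  have "1 < q \<or> q = 1"
  proof (cases "c = 1")
    case False
    with assms q have "0 < [:c - 1:]" by simp
    also have "[:c - 1:] = q - 1" using q by (simp add: one_pCons)
    finally show ?thesis by simp
  qed (simp add: q one_pCons)
  then show ?thesis by auto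
next
  case False
  then have "degree (q + (- 1)) = degree q" by (intro degree_add_eq_left) simp
  then have "lead_coeff (q - 1) = lead_coeff q" using False by simp
  with assms have "0 < q - 1" by (metis lead_coeff_pos_iff)
  then show ?thesis by simp
qed

text \<open>Two positive leading coefficients cannot cancel. This is what turns the polynomial
  equations below into exact equations between degrees.\<close>

lemma degree_add_pos:
  fixes q r :: "int poly"
  assumes "0 < q" "0 < r"
  shows "degree (q + r) = max (degree q) (degree r)"
proof (rule antisym)
  consider "degree q < degree r" | "degree r < degree q" | "degree q = degree r" by linarith
  then show "max (degree q) (degree r) \<le> degree (q + r)"
  proof cases
    case 3
    have "coeff (q + r) (degree q) > 0"
      using assms 3 by (metis add_pos_pos coeff_add lead_coeff_pos_iff)
    then show ?thesis using 3 by (simp add: le_degree)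
  qed (simp_all add: degree_add_eq_left degree_add_eq_right)
qed (rule degree_add_le_max)

lemma cong_zero_iff_dvd: "cong_zero Q m \<longleftrightarrow> [:m:] dvd Q"
  by (simp add: cong_zero_def dvd_def)

text \<open>Unfolding these rules breaks compound constants into ring expressions in atomic ones, so
  that \<open>algebra\<close> can handle identities mixing constants and polynomials.\<close>

lemma poly_const_add: "[:a + b:] = [:a:] + [:b :: int:]"
  and poly_const_diff: "[:a - b:] = [:a:] - [:b:]"
  and poly_const_mult: "[:a * b:] = [:a:] * [:b:]"
  and poly_const_power: "[:a ^ n:] = [:a:] ^ n"
  and poly_const_numeral: "[:numeral k:] = (numeral k :: int poly)"
  and poly_const_one: "[:1:] = (1 :: int poly)"
  by (simp_all add: numeral_poly one_pCons poly_const_pow)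

lemmas poly_const = poly_const_add poly_const_diff poly_const_mult poly_const_power
  poly_const_numeral poly_const_one

text \<open>Brings coprimality from \<int>[X] down to \<int>: the constant polynomial
  \<open>[:gcd a b:]\<close> is itself a common divisor, and it is a unit only if the integer
  is.\<close>

lemma gcd_eq_one_if_const_dvd_unit:
  fixes a b :: int
  assumes "\<And>d. [:d:] dvd [:a:] \<Longrightarrow> [:d:] dvd [:b:] \<Longrightarrow> is_unit [:d:]"
  shows "gcd a b = 1"
proof -
  have "is_unit [:gcd a b:]" by (intro assms) simp_all
  then have "is_unit (gcd a b)" by (simp add: is_unit_const_poly_iff)
  then show ?thesis by simp
qed

section \<open>Egyptian fractions as polynomial identities\<close>

lemma egyptian_3I:
  fixes p x y z :: "int poly"
  assumes "0 < p" "0 < x" "0 < y" "0 < z" "4 * (x * y * z) = p * (x * y + x * z + y * z)"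
  shows "egyptian 3 (4 / to_fract p)"
proof -
  have nz: "to_fract x \<noteq> 0" "to_fract y \<noteq> 0" "to_fract z \<noteq> 0" "to_fract p \<noteq> 0"
    using assms by auto
  have "to_fract (4 * (x * y * z)) = to_fract (p * (x * y + x * z + y * z))"
    using assms(5) by (rule arg_cong)
  moreover have "to_fract 4 = (4 :: int poly fract)"
    by (metis of_nat_fract of_nat_numeral to_fract_def)
  ultimately have "4 / to_fract p = 1 / to_fract x + (1 / to_fract y + 1 / to_fract z)"
    using nz by (simp add: field_simps)
  then show ?thesis
    unfolding egyptian_def using assms
    by (intro exI[of _ "[x, y, z]"]) (simp add: A_plus_def lead_coeff_pos_iff)
qed

text \<open>A sum of one or two inverses is padded to exactly three by splitting 1/Q into two copies
  of 1/(2Q); the empty sum is excluded because 4/p is not 0.\<close>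

lemma egyptian_3E:
  fixes p :: "int poly"
  assumes "0 < p" "egyptian 3 (4 / to_fract p)"
  obtains x y z :: "int poly" where "0 < x" "0 < y" "0 < z"
    "4 * (x * y * z) = p * (x * y + x * z + y * z)"
proof -
  have c: "to_fract 4 = (4 :: int poly fract)" "to_fract 2 = (2 :: int poly fract)"
    by (metis of_nat_fract of_nat_numeral to_fract_def)+
  have split: "1 / to_fract Q = 1 / to_fract (2 * Q) + 1 / to_fract (2 * Q)" for Q :: "int poly"
    by (simp add: c)
  obtain Qs where Qs: "length Qs \<le> 3" "set Qs \<subseteq> A_plus"
      "4 / to_fract p = (\<Sum>Q\<leftarrow>Qs. 1 / to_fract Q)"
    using assms(2) unfolding egyptian_def by blast
  have "\<exists>x y z. 0 < x \<and> 0 < y \<and> 0 < z \<and>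
      4 / to_fract p = 1 / to_fract x + 1 / to_fract y + 1 / to_fract z"
  proof -
    consider "Qs = []" | x where "Qs = [x]" | x y where "Qs = [x, y]" | x y z where "Qs = [x, y, z]"
      using Qs(1) by (cases Qs rule: remdups_adj.cases; cases "tl (tl Qs)"; force)
    then show ?thesis
    proof cases
      case 1
      then show ?thesis using Qs(3) assms(1) c(1)
        by (metis divide_eq_0_iff less_irrefl list.simps(8) sum_list.Nil to_fract_eq_0_iff zero_neq_numeral)
    next
      case (2 x)
      then have "0 < 2 * x" "0 < 2 * (2 * x)" using Qs(2) by (simp_all add: A_plus_def lead_coeff_pos_iff)
      moreover have "4 / to_fract p = 1 / to_fract (2 * x) + 1 / to_fract (2 * (2 * x)) + 1 / to_fract (2 * (2 * x))"
        using Qs(3) 2 split[of x] split[of "2 * x"]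
        by (simp del: to_fract_mult)
      ultimately show ?thesis by blast
    next
      case (3 x y)
      then have "0 < x" "0 < 2 * y" using Qs(2) by (simp_all add: A_plus_def lead_coeff_pos_iff)
      moreover have "4 / to_fract p = 1 / to_fract x + 1 / to_fract (2 * y) + 1 / to_fract (2 * y)"
        using Qs(3) 3 split[of y] by (simp del: to_fract_mult)
      ultimately show ?thesis by blast
    next
      case (4 x y z)
      then show ?thesis using Qs(2,3)
        by (intro exI[of _ x] exI[of _ y] exI[of _ z]) (simp add: A_plus_def lead_coeff_pos_iff)
    qed
  qed
  then obtain x y z where xyz: "0 < x" "0 < y" "0 < z"
      "4 / to_fract p = 1 / to_fract x + 1 / to_fract y + 1 / to_fract z" by blast
  have nz: "to_fract x \<noteq> 0" "to_fract y \<noteq> 0" "to_fract z \<noteq> 0" "to_fract p \<noteq> 0"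
    using xyz assms(1) by auto
  have "to_fract (4 * (x * y * z)) = to_fract (p * (x * y + x * z + y * z))"
    using xyz(4) nz c by (simp add: field_simps)
  then have "4 * (x * y * z) = p * (x * y + x * z + y * z)" by (simp only: to_fract_eq_iff)
  with xyz show ?thesis using that by blast
qed

text \<open>The hypothesis is \<open>m * E = A + B\<close> with \<open>E = 4 * A * B * D - p\<close>
  substituted.\<close>

lemma egyptian_if_type1:
  fixes p A B D m :: "int poly"
  assumes "0 < p" "0 < A" "0 < B" "0 < D" "0 < m" "m * (4 * A * B * D - p) = A + B"
  shows "egyptian 3 (4 / to_fract p)"
  by (rule egyptian_3I[of p "A * B * D" "p * m * D * A" "p * m * D * B"])
    (use assms(1-5) in simp_all, use assms(6) in algebra)

text \<open>The hypothesis is \<open>m * E = A + B\<close> multiplied by \<open>p\<close>, with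
  \<open>p * E\<close> replaced by \<open>4 * A * B * D - 1\<close>; thus no \<open>E\<close> has to
  be exhibited.\<close>

lemma egyptian_if_type2:
  fixes p A B D m :: "int poly"
  assumes "0 < p" "0 < A" "0 < B" "0 < D" "0 < m" "m * (4 * A * B * D - 1) = p * (A + B)"
  shows "egyptian 3 (4 / to_fract p)"
  by (rule egyptian_3I[of p "p * A * B * D" "m * D * A" "m * D * B"])
    (use assms(1-5) in simp_all, use assms(6) in algebra)

section \<open>Coprime factors of two denominators\<close>

lemma coprime_add_mult:
  fixes A B :: "'a :: ring_gcd"
  assumes "coprime A B" shows "coprime (A * B) (A + B)"
proof -
  have "coprime A (A + B)" "coprime B (A + B)"
    using assms by (metis coprime_iff_gcd_eq_1 gcd_add2 gcd_add1 add.commute gcd.commute)+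
  then show ?thesis by simp
qed

text \<open>Factor out the gcd; should it be negative, change the sign of all three factors.\<close>

lemma coprime_quotient_pos:
  fixes y z :: "int poly"
  assumes "0 < y" "0 < z"
  obtains g A B where "0 < g" "0 < A" "0 < B" "coprime A B" "y = g * A" "z = g * B"
proof -
  have "gcd y z \<noteq> 0" using assms by simp
  then obtain A B where AB: "y = A * gcd y z" "z = B * gcd y z" "coprime A B"
    using gcd_coprime_exists by blast
  consider "0 < gcd y z" | "0 < - gcd y z" using \<open>gcd y z \<noteq> 0\<close> by (metis neg_0_less_iff_less linorder_neqE)
  then show ?thesis
  proof cases
    case 1
    with AB assms that[of "gcd y z" A B] show ?thesis
      by (metis mult.commute zero_less_mult_pos)
  next
    case 2
    with AB assms that[of "- gcd y z" "- A" "- B"] show ?thesis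
      by (metis mult.commute zero_less_mult_pos minus_mult_minus coprime_minus_left_iff coprime_minus_right_iff)
  qed
qed

subsection \<open>Parametrisation of the solutions\<close>

text \<open>With \<open>y = g * A\<close> and \<open>z = g * B\<close> the equation becomes
  \<open>g * A * B * (4 * x - p) = x * (A + B)\<close>. Coprimality first gives
  \<open>g * A * B = x * m\<close>, then \<open>g = m * D\<close>, hence
  \<open>x = A * B * D\<close>; \<open>E\<close> is \<open>4 * x - p\<close>.\<close>

lemma type1_if_sum:
  fixes p x y z :: "int poly"
  assumes "0 < x" "0 < y" "0 < z" "coprime p x"
    and eq: "4 * (x * y * z) = x * (y + z) + p * (y * z)"
  obtains A B D E m where "0 < A" "0 < B" "0 < D" "0 < E" "0 < m" "coprime A B"
    "p + E = 4 * A * B * D" "m * E = A + B"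
proof -
  obtain g A B where g: "0 < g" "0 < A" "0 < B" "coprime A B" "y = g * A" "z = g * B"
    using coprime_quotient_pos assms(2,3) by blast
  have "g * (g * A * B * (4 * x - p)) = g * (x * (A + B))" using eq g(5,6) by algebra
  then have eq': "(g * A * B) * (4 * x - p) = x * (A + B)" using g(1) by simp
  have "coprime x (4 * x - p)"
  proof (rule coprimeI)
    fix d assume "d dvd x" "d dvd 4 * x - p"
    then have "d dvd p" by (metis dvd_diff dvd_mult diff_diff_eq2 add_diff_cancel_left')
    with \<open>d dvd x\<close> assms(4) show "is_unit d" by (rule coprime_common_divisor[rotated -1])
  qed
  moreover have "x dvd (g * A * B) * (4 * x - p)" using eq' by simp
  ultimately have "x dvd g * A * B" by (simp add: coprime_dvd_mult_left_iff)
  then obtain m where m: "g * A * B = x * m" by blast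
  have "x * (m * (4 * x - p)) = x * (A + B)" using eq' m by algebra
  then have mE: "m * (4 * x - p) = A + B" using assms(1) by simp
  \<comment> \<open>A divisor of \<open>A + B\<close> is coprime to \<open>A * B\<close>, so
    \<open>m\<close> must divide \<open>g\<close>.\<close>
  have "m dvd A + B" using mE by (metis dvd_triv_left)
  then have "coprime m (A * B)"
    using coprime_add_mult[OF g(4)] by (metis coprime_commute coprime_divisors dvd_refl)
  moreover have "m dvd g * (A * B)" using m by (metis dvd_triv_right mult.assoc)
  ultimately have "m dvd g" by (simp add: coprime_dvd_mult_left_iff)
  then obtain D where D: "g = m * D" by blast
  have "0 < x * m" using m g by (metis mult_pos_pos)
  then have "0 < m" using assms(1) by (metis zero_less_mult_pos)
  then have "0 < D" using D g(1) by (metis zero_less_mult_pos)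
  have "m * x = m * (A * B * D)" using m D by algebra
  then have x: "x = A * B * D" using \<open>0 < m\<close> by simp
  have "0 < m * (4 * x - p)" using mE g by simp
  then have "0 < 4 * x - p" using \<open>0 < m\<close> by (metis zero_less_mult_pos)
  then show ?thesis
    using that[of A B D "4 * x - p" m] g \<open>0 < m\<close> \<open>0 < D\<close> mE x by (simp add: mult.assoc)
qed

text \<open>The same descent with \<open>4 * x - 1\<close>, which is always coprime to
  \<open>x\<close>. The new point is that the prime \<open>p\<close> on the right-hand side must
  divide \<open>4 * x - 1\<close>, and the quotient is \<open>E\<close>.\<close>

lemma type2_if_sum:
  fixes p x y z :: "int poly"
  assumes "0 < p" "prime_elem p" "0 < x" "0 < y" "0 < z" "\<not> p dvd y" "\<not> p dvd z"
    and eq: "4 * (x * y * z) = p * x * (y + z) + y * z"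
  obtains A B D E m where "0 < A" "0 < B" "0 < D" "0 < E" "0 < m" "coprime A B"
    "p * E + 1 = 4 * A * B * D" "m * E = A + B"
proof -
  obtain g A B where g: "0 < g" "0 < A" "0 < B" "coprime A B" "y = g * A" "z = g * B"
    using coprime_quotient_pos assms(4,5) by blast
  have pg: "\<not> p dvd g" "\<not> p dvd A" "\<not> p dvd B" using assms(6,7) g(5,6) by auto
  have "g * (g * A * B * (4 * x - 1)) = g * (p * x * (A + B))" using eq g(5,6) by algebra
  then have eq': "(g * A * B) * (4 * x - 1) = p * x * (A + B)" using g(1) by simp
  have "coprime x (4 * x - 1)"
  proof (rule coprimeI)
    fix d assume "d dvd x" "d dvd 4 * x - 1"
    then show "is_unit d" by (metis dvd_diff dvd_mult diff_diff_eq2 add_diff_cancel_left')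
  qed
  moreover have "x dvd (g * A * B) * (4 * x - 1)" using eq' by simp
  ultimately have "x dvd g * A * B" by (simp add: coprime_dvd_mult_left_iff)
  then obtain m where m: "g * A * B = x * m" by blast
  have "x * (m * (4 * x - 1)) = x * (p * (A + B))" using eq' m by algebra
  then have mE: "m * (4 * x - 1) = p * (A + B)" using assms(3) by simp
  \<comment> \<open>Since \<open>m\<close> now divides \<open>p * (A + B)\<close> instead of
    \<open>A + B\<close>, coprimality with \<open>p\<close> is needed as well.\<close>
  have "coprime (A * B) p"
    using pg assms(2) by (simp add: prime_elem_imp_coprime coprime_commute[of _ p])
  then have "coprime (A * B) (p * (A + B))" using coprime_add_mult[OF g(4)] by simp
  then have "coprime m (A * B)" using mE
    by (metis coprime_commute coprime_divisors dvd_refl dvd_triv_left)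
  moreover have "m dvd g * (A * B)" using m by (metis dvd_triv_right mult.assoc)
  ultimately have "m dvd g" by (simp add: coprime_dvd_mult_left_iff)
  then obtain D where D: "g = m * D" by blast
  have "0 < x * m" using m g by (metis mult_pos_pos)
  then have "0 < m" using assms(3) by (metis zero_less_mult_pos)
  then have "0 < D" using D g(1) by (metis zero_less_mult_pos)
  have "m * x = m * (A * B * D)" using m D by algebra
  then have x: "x = A * B * D" using \<open>0 < m\<close> by simp
  have "\<not> p dvd m" using pg(1) \<open>m dvd g\<close> dvd_trans by blast
  moreover have "p dvd m * (4 * x - 1)" unfolding mE by (rule dvd_triv_left)
  ultimately have "p dvd 4 * x - 1" using assms(2) by (simp only: prime_elem_dvd_mult_iff simp_thms)
  then obtain E where E: "4 * x - 1 = p * E" by blast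
  have "p * (m * E) = p * (A + B)" using mE E by algebra
  then have mE': "m * E = A + B" using assms(1) by simp
  then have "0 < m * E" using g by simp
  then have "0 < E" using \<open>0 < m\<close> by (metis zero_less_mult_pos)
  moreover have "p * E + 1 = 4 * A * B * D" using E x by algebra
  ultimately show ?thesis
    using that[of A B D E m] g \<open>0 < m\<close> \<open>0 < D\<close> mE' by blast
qed

text \<open>Each inverse is at most 1, so three of them cannot add up to 4. This rules out that
  \<open>p\<close> divides all three denominators.\<close>

lemma no_three_unit_fractions:
  fixes x y z :: "int poly"
  assumes "0 < x" "0 < y" "0 < z"
  shows "4 * (x * y * z) \<noteq> x * y + x * z + y * z"
proof -
  have *: "a * b \<le> a * b * c" if "0 < a" "0 < b" "0 < c" for a b c :: "int poly"
    using that one_le_pos_poly[of c] by simp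
  have "x * y \<le> x * y * z" "x * z \<le> x * y * z" "y * z \<le> x * y * z"
    using *[of x y z] *[of x z y] *[of y z x] assms by (simp_all add: mult_ac)
  moreover have "0 < x * y * z" using assms by simp
  ultimately show ?thesis by linarith
qed

text \<open>A product of two linear polynomials has nonnegative discriminant, while that of the
  right-hand side is \<open>- 4 * p1 ^ 2 * c\<close>.\<close>

lemma no_linear_factors_of_square_plus_pos:
  fixes F G p :: "int poly" and c :: int
  assumes "degree F = 1" "degree G = 1" "degree p = 1" "c > 0"
  shows "F * G \<noteq> p ^ 2 + [:c:]"
proof
  assume eq: "F * G = p ^ 2 + [:c:]"
  have lin: "\<exists>a b. q = [:a, b:]" if "degree q = 1" for q :: "int poly"
  proof (cases q)
    case (pCons a r)
    with that have "degree r = 0" by (simp split: if_splits)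
    with pCons show ?thesis by (metis degree_eq_zeroE)
  qed
  from lin[OF assms(1)] lin[OF assms(2)] lin[OF assms(3)]
  obtain f0 f1 g0 g1 p0 p1 where F: "F = [:f0, f1:]" and G: "G = [:g0, g1:]" and p: "p = [:p0, p1:]"
    by blast
  have 1: "f1 * g1 = p1 ^ 2" and 2: "f0 * g1 + f1 * g0 = 2 * p0 * p1" and 3: "f0 * g0 = p0 ^ 2 + c"
    using eq by (simp_all add: F G p power2_eq_square algebra_simps)
  have "p1 \<noteq> 0" using assms(3) p by auto
  \<comment> \<open>The discriminant of \<open>F * G\<close> is the square of the resultant of the
    two linear factors.\<close>
  have "0 \<le> (f0 * g1 - f1 * g0) ^ 2" by simp
  also have "\<dots> = (f0 * g1 + f1 * g0) ^ 2 - 4 * (f1 * g1) * (f0 * g0)" by algebra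
  also have "\<dots> = - 4 * p1 ^ 2 * c" unfolding 1 2 3 by algebra
  also have "\<dots> < 0" using \<open>p1 \<noteq> 0\<close> assms(4) by simp
  finally show False by simp
qed

subsection \<open>Degree considerations\<close>

text \<open>An irreducible polynomial of positive degree is primitive: the cofactor of
  \<open>[:d:]\<close> has positive degree and so is not a unit.\<close>

lemma const_dvd_irreducible_poly:
  fixes p :: "int poly"
  assumes "irreducible p" "degree p > 0" "[:d:] dvd p"
  shows "is_unit [:d:]"
proof -
  from assms(3) obtain r where r: "p = [:d:] * r" by blast
  have "is_unit [:d:] \<or> is_unit r" using assms(1) r by (rule irreducibleD)
  moreover have "degree r > 0" using assms(2) r by (metis degree_mult_le degree_pCons_0 add_0 leD neq0_conv)
  ultimately show ?thesis by (auto elim: is_unit_polyE)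
qed

text \<open>A common divisor of \<open>a\<close> and \<open>b\<close> would divide the primitive
  polynomial \<open>p\<close>. Most gcd clauses of the seven conditions follow in this way.\<close>

lemma gcd_eq_one_if_dvd_irreducible_add:
  fixes p :: "int poly"
  assumes "irreducible p" "degree p > 0" and dvd: "[:a:] dvd p + [:b:]"
  shows "gcd a b = 1"
proof (rule gcd_eq_one_if_const_dvd_unit)
  fix d assume d: "[:d:] dvd [:a:]" "[:d:] dvd [:b:]"
  from d(1) dvd have "[:d:] dvd p + [:b:]" by (rule dvd_trans)
  with d(2) have "[:d:] dvd p" by (simp only: dvd_add_left_iff)
  with assms(1,2) show "is_unit [:d:]" by (rule const_dvd_irreducible_poly)
qed

lemma gcd_eq_one_if_coprime_poly:
  fixes A :: "int poly"
  assumes "coprime A [:b:]" "[:c:] * E = A + [:b:]"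
  shows "gcd b c = 1"
proof (rule gcd_eq_one_if_const_dvd_unit)
  fix d assume d: "[:d:] dvd [:b:]" "[:d:] dvd [:c:]"
  then have "[:d:] dvd A" using assms(2) by (metis dvd_add_left_iff dvd_mult2)
  with d(1) assms(1) show "is_unit [:d:]" by (rule coprime_common_divisor[rotated -1])
qed

text \<open>Exactly one of \<open>A\<close>, \<open>B\<close>, \<open>D\<close> turns out to be
  linear, and it is not \<open>B\<close>. If it is \<open>D\<close>, (1b) results; if it is
  \<open>A\<close>, then (1a) or (1c) results according to whether \<open>E\<close> or
  \<open>m\<close> is linear.\<close>

lemma type1_cases:
  fixes p A B D E m :: "int poly"
  assumes p: "0 < p" "degree p = 1" "irreducible p"
    and pos: "0 < A" "0 < B" "0 < D" "0 < E" "0 < m"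
    and cop: "coprime A B" and pE: "p + E = 4 * A * B * D" and mE: "m * E = A + B"
    and deg: "degree B \<le> degree A"
  shows "(\<exists>B C D :: int. B > 0 \<and> C > 0 \<and> D > 0 \<and> gcd B C = 1 \<and>
        cong_zero ([:B:] + p * [:C:]) (4 * B * C * D - 1)) \<or>
    (\<exists>A B E :: int. A > 0 \<and> B > 0 \<and> E > 0 \<and> gcd A B = 1 \<and> gcd (4 * A * B) E = 1 \<and>
        cong_zero (p + [:E:]) (4 * A * B) \<and> cong_zero [:A + B:] E) \<or>
    (\<exists>B D E :: int. B > 0 \<and> D > 0 \<and> E > 0 \<and> gcd (4 * B * D) E = 1 \<and>
        cong_zero (p + [:E:] + [:4 * B ^ 2 * D:]) (4 * B * D * E))" (is "?P1a \<or> ?P1b \<or> ?P1c")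
proof -
  have nz: "A \<noteq> 0" "B \<noteq> 0" "D \<noteq> 0" "E \<noteq> 0" "m \<noteq> 0" using pos by auto
  have "degree (p + E) = degree A + degree B + degree D"
    unfolding pE using nz by (simp add: degree_mult_eq)
  then have degpE: "max 1 (degree E) = degree A + degree B + degree D"
    using degree_add_pos[OF p(1) pos(4)] p(2) by simp
  have "degree (m * E) = max (degree A) (degree B)"
    unfolding mE using pos by (simp add: degree_add_pos)
  then have degmE: "degree m + degree E = degree A" using nz deg by (simp add: degree_mult_eq)
  \<comment> \<open>Obtained by eliminating \<open>E\<close>.\<close>
  have A_eq: "A * (4 * m * B * D - 1) = B + p * m" using pE mE by algebra
  have "degree E \<le> 1"
  proof (rule ccontr)
    assume "\<not> degree E \<le> 1"
    \<comment> \<open>If \<open>E\<close> had degree above 1, then \<open>A\<close> would have the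
      same degree, but the right-hand side of \<open>A_eq\<close> would only be linear.\<close>
    with degpE degmE have d: "degree m = 0" "degree B = 0" "degree D = 0" "degree A > 1" by auto
    have "1 \<le> m * B * D" using pos by (intro one_le_pos_poly) simp
    then have "4 * m * B * D - 1 \<noteq> 0" by (simp add: mult.assoc)
    then have "degree A \<le> degree (A * (4 * m * B * D - 1))" using nz by (simp add: degree_mult_eq)
    also have "\<dots> = max (degree B) (degree p + degree m)"
      unfolding A_eq using pos p nz by (subst degree_add_pos) (auto simp: degree_mult_eq)
    finally show False using d p by simp
  qed
  then have "degree A + degree B + degree D = 1" using degpE by simp
  then consider (D) "degree A = 0" "degree B = 0" "degree E = 0"
    | (E) "degree B = 0" "degree D = 0" "degree m = 0"
    | (A) "degree B = 0" "degree D = 0" "degree E = 0"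
    using degmE deg \<open>degree E \<le> 1\<close> by linarith
  then show ?thesis
  proof cases
    case D
    then obtain a b e where c: "A = [:a:]" "B = [:b:]" "E = [:e:]" by (metis degree_eq_zeroE)
    have dvd: "[:4 * a * b:] dvd p + [:e:]"
      by (rule dvdI[of _ _ D]) (unfold poly_const, use pE c in algebra)
    have "gcd a b = 1" using cop c by (metis gcd_eq_one_if_const_dvd_unit coprime_common_divisor)
    moreover have "gcd (4 * a * b) e = 1"
      using dvd p by (intro gcd_eq_one_if_dvd_irreducible_add) auto
    moreover have "[:e:] dvd [:a + b:]" using mE c by (metis poly_const_add dvd_triv_right)
    ultimately have "a > 0 \<and> b > 0 \<and> e > 0 \<and> gcd a b = 1 \<and> gcd (4 * a * b) e = 1 \<and>
        cong_zero (p + [:e:]) (4 * a * b) \<and> cong_zero [:a + b:] e"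
      using dvd pos c by (simp add: cong_zero_iff_dvd)
    then have ?P1b by (intro exI)
    then show ?thesis by (rule disjI2[OF disjI1])
  next
    case E
    then obtain b c d where c: "B = [:b:]" "m = [:c:]" "D = [:d:]" by (metis degree_eq_zeroE)
    have "[:4 * b * c * d - 1:] dvd [:b:] + p * [:c:]"
      by (rule dvdI[of _ _ A]) (unfold poly_const, use A_eq c in algebra)
    moreover have "gcd b c = 1" using cop mE c by (metis gcd_eq_one_if_coprime_poly)
    ultimately have "b > 0 \<and> c > 0 \<and> d > 0 \<and> gcd b c = 1 \<and>
        cong_zero ([:b:] + p * [:c:]) (4 * b * c * d - 1)"
      using pos c by (simp add: cong_zero_iff_dvd)
    then have ?P1a by (intro exI)
    then show ?thesis by (rule disjI1)
  next
    case A
    then obtain b d e where c: "B = [:b:]" "D = [:d:]" "E = [:e:]" by (metis degree_eq_zeroE)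
    have dvd: "[:4 * b * d:] dvd p + [:e:]"
      by (rule dvdI[of _ _ A]) (unfold poly_const, use pE c in algebra)
    \<comment> \<open>Multiply \<open>m * E = A + B\<close> by \<open>4 * B * D\<close> and
      substitute \<open>p + E\<close> for \<open>4 * A * B * D\<close>.\<close>
    have "[:4 * b * d * e:] dvd p + [:e:] + [:4 * b ^ 2 * d:]"
      by (rule dvdI[of _ _ m]) (unfold poly_const, use pE mE c in algebra)
    moreover have "gcd (4 * b * d) e = 1"
      using dvd p by (intro gcd_eq_one_if_dvd_irreducible_add) auto
    ultimately have "b > 0 \<and> d > 0 \<and> e > 0 \<and> gcd (4 * b * d) e = 1 \<and>
        cong_zero (p + [:e:] + [:4 * b ^ 2 * d:]) (4 * b * d * e)"
      using pos c by (simp add: cong_zero_iff_dvd)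
    then have ?P1c by (intro exI)
    then show ?thesis by (rule disjI2[OF disjI2])
  qed
qed

text \<open>The letters stand for the degrees of \<open>A\<close>, \<open>B\<close>,
  \<open>D\<close>, \<open>E\<close>, \<open>F\<close>, \<open>m\<close>. The first two equations
  give \<open>m + b + d = 1\<close>, so exactly one of these three is linear. Cases \<open>a\<close>
  to \<open>d\<close> lead to (2a) to (2d); \<open>lin\<close> is the spurious one.\<close>

lemma type2_degree_cases [consumes 4]:
  fixes a b d e f m :: nat
  assumes "a + b + d = 1 + e" "m + e = a" "f + e = b + b + d" "b \<le> a"
  obtains (a) "a = 0" "b = 0" "e = 0" | (b) "b = 0" "m = 0" "f = 0"
    | (c) "b = 0" "d = 0" "f = 0" "e = 0" | (d) "m = 0" "d = 0" "f = 0"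
    | (lin) "f = 1" "a = 1" "d = 0" "m = 0"
proof -
  have "m + b + d = 1" using assms by linarith
  then consider "m = 1" "b = 0" "d = 0" | "d = 1" "m = 0" "b = 0" | "b = 1" "m = 0" "d = 0"
    by linarith
  then show ?thesis
  proof cases
    case 1
    then show ?thesis using assms by (intro c) auto
  next
    case 2
    then have "f + a = 1" using assms by linarith
    then consider "f = 0" | "a = 0" by linarith
    then show ?thesis using assms 2 a b by cases auto
  next
    case 3
    then have "f + a = 2" "a \<ge> 1" using assms by linarith+
    then consider "f = 0" | "f = 1" "a = 1" by linarith
    then show ?thesis using 3 d lin by cases auto
  qed
qed

text \<open>The auxiliary \<open>F\<close> satisfies \<open>F * A = p * B + m\<close> and
  \<open>F * E = 4 * B ^ 2 * D + 1\<close>. It is constant in every case except possibly (2a) and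
  the impossible one.\<close>

lemma type2_cases:
  fixes p A B D E m :: "int poly"
  assumes p: "0 < p" "degree p = 1" "irreducible p"
    and pos: "0 < A" "0 < B" "0 < D" "0 < E" "0 < m"
    and cop: "coprime A B" and pE: "p * E + 1 = 4 * A * B * D" and mE: "m * E = A + B"
    and deg: "degree B \<le> degree A"
  shows "(\<exists>A B E :: int. A > 0 \<and> B > 0 \<and> E > 0 \<and> gcd A B = 1 \<and> gcd (4 * A * B) E = 1 \<and>
        cong_zero (p * [:E:] + 1) (4 * A * B) \<and> cong_zero [:A + B:] E) \<or>
    (\<exists>B C F :: int. B > 0 \<and> C > 0 \<and> F > 0 \<and> gcd B C = 1 \<and> gcd (4 * B * C) F = 1 \<and>
        cong_zero (p + [:F:]) (4 * B * C) \<and> cong_zero (p * [:B:] + [:C:]) F) \<or>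
    (\<exists>B D F :: int. B > 0 \<and> D > 0 \<and> F > 0 \<and> gcd (4 * B * D) F = 1 \<and>
        cong_zero (p + [:F:]) (4 * B * D) \<and> cong_zero [:4 * B ^ 2 * D + 1:] F) \<or>
    (\<exists>C D F :: int. C > 0 \<and> D > 0 \<and> F > 0 \<and> gcd (4 * C * D) F = 1 \<and>
        cong_zero (p + [:F:]) (4 * C * D) \<and> cong_zero (p ^ 2 + [:4 * C ^ 2 * D:]) F)" (is "?P2a \<or> ?P2b \<or> ?P2c \<or> ?P2d")
proof -
  have nz: "A \<noteq> 0" "B \<noteq> 0" "D \<noteq> 0" "E \<noteq> 0" "m \<noteq> 0" using pos by auto
  have "degree (4 * A * B * D) = max (degree (p * E)) 0"
    unfolding pE[symmetric] using p pos by (subst degree_add_pos) auto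
  then have degpE: "degree A + degree B + degree D = 1 + degree E"
    using nz p by (simp add: degree_mult_eq)
  have "degree (m * E) = max (degree A) (degree B)"
    unfolding mE using pos by (simp add: degree_add_pos)
  then have degmE: "degree m + degree E = degree A" using nz deg by (simp add: degree_mult_eq)
  define F where "F = 4 * m * B * D - p"
  have pF: "p + F = 4 * m * B * D" by (simp add: F_def)
  have FA: "F * A = p * B + m" using pE mE unfolding F_def by algebra
  have FE: "F * E = 4 * B ^ 2 * D + 1" using pE mE unfolding F_def by algebra
  have "0 < F * A" unfolding FA using p pos by (simp add: add_pos_pos)
  then have "0 < F" using pos(1) by (metis mult.commute zero_less_mult_pos)
  have "degree (F * E) = degree B + degree B + degree D"
    unfolding FE using pos nz by (subst degree_add_pos) (auto simp: degree_mult_eq power2_eq_square)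
  then have degFE: "degree F + degree E = degree B + degree B + degree D"
    using nz \<open>0 < F\<close> by (simp add: degree_mult_eq)
  from degpE degmE degFE deg show ?thesis
  proof (cases rule: type2_degree_cases)
    case a
    then obtain a b e where c: "A = [:a:]" "B = [:b:]" "E = [:e:]" by (metis degree_eq_zeroE)
    have dvd: "[:4 * a * b:] dvd p * [:e:] + 1"
      by (rule dvdI[of _ _ D]) (unfold poly_const, use pE c in algebra)
    have "gcd a b = 1" using cop c by (metis gcd_eq_one_if_const_dvd_unit coprime_common_divisor)
    \<comment> \<open>A common divisor divides both \<open>p * [:e:] + 1\<close> and
      \<open>p * [:e:]\<close>, hence 1.\<close>
    moreover have "gcd (4 * a * b) e = 1"
      by (rule gcd_eq_one_if_const_dvd_unit) (meson dvd dvd_add_right_iff dvd_mult dvd_trans)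
    moreover have "[:e:] dvd [:a + b:]" using mE c by (metis poly_const_add dvd_triv_right)
    ultimately have "a > 0 \<and> b > 0 \<and> e > 0 \<and> gcd a b = 1 \<and> gcd (4 * a * b) e = 1 \<and>
        cong_zero (p * [:e:] + 1) (4 * a * b) \<and> cong_zero [:a + b:] e"
      using dvd pos c by (simp add: cong_zero_iff_dvd)
    then have ?P2a by (intro exI)
    then show ?thesis by (rule disjI1)
  next
    case b
    then obtain b c f where c: "B = [:b:]" "m = [:c:]" "F = [:f:]" by (metis degree_eq_zeroE)
    have eq: "4 * m * B * D = [:4 * b * c:] * D" unfolding poly_const c by algebra
    have dvd: "[:4 * b * c:] dvd p + [:f:]" using pF eq c by (metis dvd_triv_left)
    have "[:f:] dvd p * [:b:] + [:c:]" using FA c by (metis dvd_triv_left)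
    moreover have "gcd b c = 1" using cop mE c by (metis gcd_eq_one_if_coprime_poly)
    moreover have "gcd (4 * b * c) f = 1"
      using dvd p by (intro gcd_eq_one_if_dvd_irreducible_add) auto
    ultimately have "b > 0 \<and> c > 0 \<and> f > 0 \<and> gcd b c = 1 \<and> gcd (4 * b * c) f = 1 \<and>
        cong_zero (p + [:f:]) (4 * b * c) \<and> cong_zero (p * [:b:] + [:c:]) f"
      using dvd pos \<open>0 < F\<close> c by (simp add: cong_zero_iff_dvd)
    then have ?P2b by (intro exI)
    then show ?thesis by (rule disjI2[OF disjI1])
  next
    case c
    then obtain b d f e where c: "B = [:b:]" "D = [:d:]" "F = [:f:]" "E = [:e:]" by (metis degree_eq_zeroE)
    have eq: "4 * m * B * D = [:4 * b * d:] * m" unfolding poly_const c by algebra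
    have dvd: "[:4 * b * d:] dvd p + [:f:]" using pF eq c by (metis dvd_triv_left)
    have "[:f:] dvd [:4 * b ^ 2 * d + 1:]"
      by (rule dvdI[of _ _ E]) (unfold poly_const, use FE c in algebra)
    moreover have "gcd (4 * b * d) f = 1"
      using dvd p by (intro gcd_eq_one_if_dvd_irreducible_add) auto
    ultimately have "b > 0 \<and> d > 0 \<and> f > 0 \<and> gcd (4 * b * d) f = 1 \<and>
        cong_zero (p + [:f:]) (4 * b * d) \<and> cong_zero [:4 * b ^ 2 * d + 1:] f"
      using dvd pos \<open>0 < F\<close> c by (simp add: cong_zero_iff_dvd)
    then have ?P2c by (intro exI)
    then show ?thesis by (rule disjI2[OF disjI2[OF disjI1]])
  next
    case d
    then obtain c d f where c: "m = [:c:]" "D = [:d:]" "F = [:f:]" by (metis degree_eq_zeroE)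
    have eq: "4 * m * B * D = [:4 * c * d:] * B" unfolding poly_const c by algebra
    have dvd: "[:4 * c * d:] dvd p + [:f:]" using pF eq c by (metis dvd_triv_left)
    \<comment> \<open>The cofactor is \<open>F\<close> with \<open>A\<close> and \<open>B\<close>
      exchanged; the product of the two is \<open>p ^ 2 + 4 * m ^ 2 * D\<close>.\<close>
    have "[:f:] dvd p ^ 2 + [:4 * c ^ 2 * d:]"
      by (rule dvdI[of _ _ "4 * m * A * D - p"]) (unfold poly_const, use FA pF c in algebra)
    moreover have "gcd (4 * c * d) f = 1"
      using dvd p by (intro gcd_eq_one_if_dvd_irreducible_add) auto
    ultimately have "c > 0 \<and> d > 0 \<and> f > 0 \<and> gcd (4 * c * d) f = 1 \<and>
        cong_zero (p + [:f:]) (4 * c * d) \<and> cong_zero (p ^ 2 + [:4 * c ^ 2 * d:]) f"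
      using dvd pos \<open>0 < F\<close> c by (simp add: cong_zero_iff_dvd)
    then have ?P2d by (intro exI)
    then show ?thesis by (rule disjI2[OF disjI2[OF disjI2]])
  next
    case lin
    then obtain c d where c: "m = [:c:]" "D = [:d:]" by (metis degree_eq_zeroE)
    \<comment> \<open>Here \<open>F * G\<close> has degree 2 and \<open>F\<close> degree 1, so
      \<open>G\<close> would be a second linear factor of a polynomial without real roots.\<close>
    define G where "G = 4 * m * A * D - p"
    have FG: "F * G = p ^ 2 + [:4 * c ^ 2 * d:]"
      unfolding poly_const G_def using FA pF c by algebra
    have "4 * c ^ 2 * d > 0" using pos c by simp
    have "degree (F * G) = 2" unfolding FG using p \<open>4 * c ^ 2 * d > 0\<close>
      by (subst degree_add_pos) (auto simp: degree_power_eq)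
    moreover have "F * G \<noteq> 0" using \<open>degree (F * G) = 2\<close> by auto
    ultimately have "degree G = 1" using lin by (simp add: degree_mult_eq)
    then show ?thesis
      using no_linear_factors_of_square_plus_pos[OF lin(1) _ p(2) \<open>4 * c ^ 2 * d > 0\<close>] FG by blast
  qed
qed

subsection \<open>Solutions from the seven conditions\<close>

lemma pos_if_const_mult_pos:
  fixes R :: "int poly"
  assumes "0 < [:c:] * R" "0 < c"
  shows "0 < R"
  using assms const_poly_pos_iff zero_less_mult_pos by metis

text \<open>The quotient \<open>R\<close> of the congruence plays the role of \<open>A\<close>, and
  \<open>C\<close> that of \<open>m\<close>.\<close>

lemma egyptian_if_condition_1a:
  fixes p :: "int poly" and B C D :: int
  assumes "0 < p" "B > 0" "C > 0" "D > 0" "cong_zero ([:B:] + p * [:C:]) (4 * B * C * D - 1)"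
  shows "egyptian 3 (4 / to_fract p)"
proof -
  obtain R where R: "[:B:] + p * [:C:] = [:4 * B * C * D - 1:] * R"
    using assms(5) by (auto simp: cong_zero_iff_dvd simp del: mult_pCons_left mult_pCons_right elim: dvdE)
  have "0 < B * C * D" using assms by simp
  then have "4 * B * C * D - 1 > 0" by (simp add: mult.assoc)
  moreover have "0 < [:B:] + p * [:C:]"
    using assms by (intro add_pos_pos mult_pos_pos) simp_all
  ultimately have "0 < R" unfolding R by (rule pos_if_const_mult_pos[rotated])
  moreover have "[:C:] * (4 * R * [:B:] * [:D:] - p) = R + [:B:]"
    using R unfolding poly_const by algebra
  ultimately show ?thesis
    using assms by (intro egyptian_if_type1[of p R "[:B:]" "[:D:]" "[:C:]"]) simp_all
qed

lemma egyptian_if_condition_1b: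
  fixes p :: "int poly" and A B E :: int
  assumes "0 < p" "A > 0" "B > 0" "E > 0" "cong_zero (p + [:E:]) (4 * A * B)" "cong_zero [:A + B:] E"
  shows "egyptian 3 (4 / to_fract p)"
proof -
  obtain D where D: "p + [:E:] = [:4 * A * B:] * D"
    using assms(5) unfolding cong_zero_iff_dvd by (rule dvdE)
  obtain m where m: "[:A + B:] = [:E:] * m"
    using assms(6) unfolding cong_zero_iff_dvd by (rule dvdE)
  have "0 < p + [:E:]" "0 < [:A + B:]" using assms by (simp_all add: add_pos_pos)
  then have "0 < D" "0 < m" unfolding D m using assms by (auto intro: pos_if_const_mult_pos)
  moreover have "m * (4 * [:A:] * [:B:] * D - p) = [:A:] + [:B:]"
    using D m unfolding poly_const by algebra
  ultimately show ?thesis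
    using assms by (intro egyptian_if_type1[of p "[:A:]" "[:B:]" D m]) simp_all
qed

lemma egyptian_if_condition_1c:
  fixes p :: "int poly" and B D E :: int
  assumes "0 < p" "B > 0" "D > 0" "E > 0"
    "cong_zero (p + [:E:] + [:4 * B ^ 2 * D:]) (4 * B * D * E)"
  shows "egyptian 3 (4 / to_fract p)"
proof -
  obtain m where m: "p + [:E:] + [:4 * B ^ 2 * D:] = [:4 * B * D * E:] * m"
    using assms(5) unfolding cong_zero_iff_dvd by (rule dvdE)
  have "0 < p + [:E:] + [:4 * B ^ 2 * D:]" using assms by (simp add: add_pos_pos)
  then have "0 < m" unfolding m using assms by (auto intro: pos_if_const_mult_pos)
  \<comment> \<open>Forced by \<open>m * E = A + B\<close>. Its positivity is not visible from the
    difference, but follows from \<open>p + E = 4 * B * D * A\<close>.\<close>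
  define A where "A = [:E:] * m - [:B:]"
  have eq: "p + [:E:] = [:4 * B * D:] * A" using m unfolding A_def poly_const by algebra
  have "0 < p + [:E:]" using assms by (simp add: add_pos_pos)
  then have "0 < A" unfolding eq using assms by (auto intro: pos_if_const_mult_pos)
  moreover have "m * (4 * A * [:B:] * [:D:] - p) = A + [:B:]"
    using eq A_def unfolding poly_const by algebra
  ultimately show ?thesis
    using \<open>0 < m\<close> assms by (intro egyptian_if_type1[of p A "[:B:]" "[:D:]" m]) simp_all
qed

lemma egyptian_if_condition_2a:
  fixes p :: "int poly" and A B E :: int
  assumes "0 < p" "A > 0" "B > 0" "E > 0" "cong_zero (p * [:E:] + 1) (4 * A * B)" "cong_zero [:A + B:] E"
  shows "egyptian 3 (4 / to_fract p)"
proof -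
  obtain D where D: "p * [:E:] + 1 = [:4 * A * B:] * D"
    using assms(5) unfolding cong_zero_iff_dvd by (rule dvdE)
  obtain m where m: "[:A + B:] = [:E:] * m"
    using assms(6) unfolding cong_zero_iff_dvd by (rule dvdE)
  have "0 < p * [:E:] + 1" using assms by (intro add_pos_pos mult_pos_pos) simp_all
  moreover have "0 < [:A + B:]" using assms by simp
  ultimately have "0 < D" "0 < m" unfolding D m using assms by (auto intro: pos_if_const_mult_pos)
  moreover have "m * (4 * [:A:] * [:B:] * D - 1) = p * ([:A:] + [:B:])"
    using D m unfolding poly_const by algebra
  ultimately show ?thesis
    using assms by (intro egyptian_if_type2[of p "[:A:]" "[:B:]" D m]) simp_all
qed

text \<open>Common core of (2b), (2c) and (2d), where \<open>F\<close> is constant and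
  \<open>C\<close> plays the role of \<open>m\<close>: multiplying \<open>pF\<close> by
  \<open>A\<close> and inserting \<open>FA\<close> eliminates \<open>F\<close>.\<close>

lemma egyptian_if_type2_const:
  fixes p A B C D :: "int poly" and F :: int
  assumes "0 < p" "0 < B" "0 < C" "0 < D" "0 < F"
    and pF: "p + [:F:] = 4 * B * C * D" and FA: "[:F:] * A = p * B + C"
  shows "egyptian 3 (4 / to_fract p)"
proof -
  have "0 < [:F:] * A" unfolding FA using assms by (intro add_pos_pos mult_pos_pos) simp_all
  then have "0 < A" using \<open>0 < F\<close> by (rule pos_if_const_mult_pos)
  moreover have "C * (4 * A * B * D - 1) = p * (A + B)" using pF FA by algebra
  ultimately show ?thesis using assms by (intro egyptian_if_type2[of p A B D C])
qed

lemma egyptian_if_condition_2b: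
  fixes p :: "int poly" and B C F :: int
  assumes "0 < p" "B > 0" "C > 0" "F > 0"
    "cong_zero (p + [:F:]) (4 * B * C)" "cong_zero (p * [:B:] + [:C:]) F"
  shows "egyptian 3 (4 / to_fract p)"
proof -
  obtain D where D: "p + [:F:] = [:4 * B * C:] * D"
    using assms(5) unfolding cong_zero_iff_dvd by (rule dvdE)
  obtain A where A: "p * [:B:] + [:C:] = [:F:] * A"
    using assms(6) unfolding cong_zero_iff_dvd by (rule dvdE)
  have "0 < p + [:F:]" using assms by (simp add: add_pos_pos)
  then have "0 < D" unfolding D using assms by (auto intro: pos_if_const_mult_pos)
  then show ?thesis
    using assms D A[symmetric]
    by (intro egyptian_if_type2_const[of p "[:B:]" "[:C:]" D F A]) (simp_all only: poly_const const_poly_pos_iff)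
qed

lemma egyptian_if_condition_2c:
  fixes p :: "int poly" and B D F :: int
  assumes "0 < p" "B > 0" "D > 0" "F > 0"
    "cong_zero (p + [:F:]) (4 * B * D)" "cong_zero [:4 * B ^ 2 * D + 1:] F"
  shows "egyptian 3 (4 / to_fract p)"
proof -
  obtain C where C: "p + [:F:] = [:4 * B * D:] * C"
    using assms(5) unfolding cong_zero_iff_dvd by (rule dvdE)
  obtain E where E: "[:4 * B ^ 2 * D + 1:] = [:F:] * E"
    using assms(6) unfolding cong_zero_iff_dvd by (rule dvdE)
  have "0 < p + [:F:]" using assms by (simp add: add_pos_pos)
  then have "0 < C" unfolding C using assms by (auto intro: pos_if_const_mult_pos)
  moreover have "p + [:F:] = 4 * [:B:] * C * [:D:]" using C unfolding poly_const by algebra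
  \<comment> \<open>The candidate for \<open>A\<close> again comes from
    \<open>m * E = A + B\<close>, with \<open>C\<close> as \<open>m\<close>.\<close>
  moreover have "[:F:] * (C * E - [:B:]) = p * [:B:] + C" using C E unfolding poly_const by algebra
  ultimately show ?thesis
    using assms by (intro egyptian_if_type2_const[of p "[:B:]" C "[:D:]" F]) simp_all
qed

text \<open>The congruence only shows that \<open>F\<close> divides
  \<open>4 * C * D * (p * B + C)\<close>; the gcd condition allows cancelling
  \<open>4 * C * D\<close>, which yields \<open>A\<close>.\<close>

lemma egyptian_if_condition_2d:
  fixes p :: "int poly" and C D F :: int
  assumes "0 < p" "C > 0" "D > 0" "F > 0" "gcd (4 * C * D) F = 1"
    "cong_zero (p + [:F:]) (4 * C * D)" "cong_zero (p ^ 2 + [:4 * C ^ 2 * D:]) F"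
  shows "egyptian 3 (4 / to_fract p)"
proof -
  obtain B where B: "p + [:F:] = [:4 * C * D:] * B"
    using assms(6) unfolding cong_zero_iff_dvd by (rule dvdE)
  have "p ^ 2 + [:4 * C ^ 2 * D:] = [:4 * C * D:] * (p * B + [:C:]) - [:F:] * p"
    using B unfolding poly_const by algebra
  then have F_dvd: "[:F:] dvd [:4 * C * D:] * (p * B + [:C:])"
    using assms(7) unfolding cong_zero_iff_dvd by (metis dvd_add dvd_triv_left diff_add_cancel)
  \<comment> \<open>A Bezout identity in \<int>, read among constant polynomials, carries
    coprimality up to \<int>[X].\<close>
  have "[:F:] * Q + [:4 * C * D:] * R = 1" if "F * q + 4 * C * D * r = 1" "Q = [:q:]" "R = [:r:]"
    for q r Q R using arg_cong[OF that(1), of "\<lambda>x. [:x:]"] that(2,3) unfolding poly_const by simp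
  moreover obtain q r where "F * q + 4 * C * D * r = 1"
    using bezout_int[of F "4 * C * D"] assms(5) by (auto simp: gcd.commute mult.commute)
  ultimately obtain Q R where "[:F:] * Q + [:4 * C * D:] * R = 1" by blast
  then have "coprime [:F:] [:4 * C * D:]"
    by (intro coprimeI) (metis dvd_add dvd_mult2)
  then have "[:F:] dvd p * B + [:C:]" using F_dvd by (simp only: coprime_dvd_mult_right_iff)
  then obtain A where A: "p * B + [:C:] = [:F:] * A" by (rule dvdE)
  have "0 < p + [:F:]" using assms by (simp add: add_pos_pos)
  then have "0 < B" unfolding B using assms by (auto intro: pos_if_const_mult_pos)
  moreover have "p + [:F:] = 4 * B * [:C:] * [:D:]" using B unfolding poly_const by algebra
  ultimately show ?thesis
    using assms A by (intro egyptian_if_type2_const[of p B "[:C:]" "[:D:]" F A]) simp_all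
qed

section \<open>Divisibility of the denominators by \<open>p\<close>, and the equivalence\<close>

theorem proposition3:
  fixes p :: "int poly"
  assumes "degree p = 1" and "lead_coeff p > 0" and "irreducible p"
  shows "egyptian 3 (4 / to_fract p) \<longleftrightarrow>
    (\<exists>B C D :: int. B > 0 \<and> C > 0 \<and> D > 0 \<and> gcd B C = 1 \<and>
        cong_zero ([:B:] + p * [:C:]) (4 * B * C * D - 1)) \<or>
    (\<exists>A B E :: int. A > 0 \<and> B > 0 \<and> E > 0 \<and> gcd A B = 1 \<and> gcd (4 * A * B) E = 1 \<and>
        cong_zero (p + [:E:]) (4 * A * B) \<and> cong_zero [:A + B:] E) \<or>
    (\<exists>B D E :: int. B > 0 \<and> D > 0 \<and> E > 0 \<and> gcd (4 * B * D) E = 1 \<and>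
        cong_zero (p + [:E:] + [:4 * B ^ 2 * D:]) (4 * B * D * E)) \<or>
    (\<exists>A B E :: int. A > 0 \<and> B > 0 \<and> E > 0 \<and> gcd A B = 1 \<and> gcd (4 * A * B) E = 1 \<and>
        cong_zero (p * [:E:] + 1) (4 * A * B) \<and> cong_zero [:A + B:] E) \<or>
    (\<exists>B C F :: int. B > 0 \<and> C > 0 \<and> F > 0 \<and> gcd B C = 1 \<and> gcd (4 * B * C) F = 1 \<and>
        cong_zero (p + [:F:]) (4 * B * C) \<and> cong_zero (p * [:B:] + [:C:]) F) \<or>
    (\<exists>B D F :: int. B > 0 \<and> D > 0 \<and> F > 0 \<and> gcd (4 * B * D) F = 1 \<and>
        cong_zero (p + [:F:]) (4 * B * D) \<and> cong_zero [:4 * B ^ 2 * D + 1:] F) \<or>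
    (\<exists>C D F :: int. C > 0 \<and> D > 0 \<and> F > 0 \<and> gcd (4 * C * D) F = 1 \<and>
        cong_zero (p + [:F:]) (4 * C * D) \<and> cong_zero (p ^ 2 + [:4 * C ^ 2 * D:]) F)" (is "?L \<longleftrightarrow> ?P1a \<or> ?P1b \<or> ?P1c \<or> ?P2a \<or> ?P2b \<or> ?P2c \<or> ?P2d")
proof -
  have p: "0 < p" "degree p = 1" "irreducible p" "prime_elem p"
    using assms lead_coeff_pos_iff irreducible_imp_prime_elem by blast+
  have type1: "?P1a \<or> ?P1b \<or> ?P1c"
    if xyz: "0 < x" "0 < y" "0 < z" "\<not> p dvd x" "p dvd y" "p dvd z"
      and eq: "4 * (x * y * z) = p * (x * y + x * z + y * z)" for x y z
  proof -
    obtain u v where uv: "y = p * u" "z = p * v" using xyz(5,6) by (elim dvdE)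
    have pos: "0 < u" "0 < v" using uv xyz p(1) zero_less_mult_pos by blast+
    have "p ^ 2 * (4 * (x * u * v)) = p ^ 2 * (x * (u + v) + p * (u * v))"
      using eq unfolding uv by algebra
    then have eq': "4 * (x * u * v) = x * (u + v) + p * (u * v)" using p(1) by simp
    have cop: "coprime p x" using p(4) xyz(4) by (rule prime_elem_imp_coprime)
    obtain A B D E m where AB: "0 < A" "0 < B" "0 < D" "0 < E" "0 < m" "coprime A B"
        "p + E = 4 * A * B * D" "m * E = A + B"
      by (rule type1_if_sum[OF xyz(1) pos cop eq'])
    \<comment> \<open>The equations are symmetric in \<open>A\<close> and \<open>B\<close>, so the
      one of larger degree may be called \<open>A\<close>.\<close>
    show ?thesis
    proof (cases "degree B \<le> degree A")
      case True
      from p(1-3) AB True show ?thesis by (rule type1_cases)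
    next
      case False
      then have "degree A \<le> degree B" by simp
      moreover have "coprime B A" "p + E = 4 * B * A * D" "m * E = B + A"
        using AB(6-8) by (simp_all add: coprime_commute ac_simps)
      ultimately show ?thesis using p(1-3) AB(1-5) by (intro type1_cases[of p B A D E m])
    qed
  qed
  have type2: "?P2a \<or> ?P2b \<or> ?P2c \<or> ?P2d"
    if xyz: "0 < x" "0 < y" "0 < z" "p dvd x" "\<not> p dvd y" "\<not> p dvd z"
      and eq: "4 * (x * y * z) = p * (x * y + x * z + y * z)" for x y z
  proof -
    obtain u where u: "x = p * u" using xyz(4) by (elim dvdE)
    have pos: "0 < u" using u xyz(1) p(1) zero_less_mult_pos by blast
    have "p * (4 * (u * y * z)) = p * (p * u * (y + z) + y * z)"
      using eq unfolding u by algebra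
    then have eq': "4 * (u * y * z) = p * u * (y + z) + y * z" using p(1) by simp
    obtain A B D E m where AB: "0 < A" "0 < B" "0 < D" "0 < E" "0 < m" "coprime A B"
        "p * E + 1 = 4 * A * B * D" "m * E = A + B"
      by (rule type2_if_sum[OF p(1,4) pos xyz(2,3,5,6) eq'])
    show ?thesis
    proof (cases "degree B \<le> degree A")
      case True
      from p(1-3) AB True show ?thesis by (rule type2_cases)
    next
      case False
      then have "degree A \<le> degree B" by simp
      moreover have "coprime B A" "p * E + 1 = 4 * B * A * D" "m * E = B + A"
        using AB(6-8) by (simp_all add: coprime_commute ac_simps)
      ultimately show ?thesis using p(1-3) AB(1-5) by (intro type2_cases[of p B A D E m])
    qed
  qed
  have forward: "(?P1a \<or> ?P1b \<or> ?P1c) \<or> (?P2a \<or> ?P2b \<or> ?P2c \<or> ?P2d)" if L: ?L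
  proof -
    obtain x y z where xyz: "0 < x" "0 < y" "0 < z"
      and eq: "4 * (x * y * z) = p * (x * y + x * z + y * z)"
      using egyptian_3E[OF p(1) L] by blast
    \<comment> \<open>Permuted forms of the equation, to bring the denominator that behaves unlike
      the other two to the front.\<close>
    have eqs: "4 * (y * x * z) = p * (y * x + y * z + x * z)"
        "4 * (z * x * y) = p * (z * x + z * y + x * y)"
      using eq by algebra+
    have "\<not> p dvd 4"
    proof
      assume "p dvd 4"
      then have "degree p \<le> degree (4 :: int poly)" by (rule dvd_imp_degree_le) simp
      then show False using p(2) by simp
    qed
    moreover have "p dvd 4 * (x * y * z)" using eq by simp
    ultimately have some: "p dvd x \<or> p dvd y \<or> p dvd z"
      using p(4) by (simp only: prime_elem_dvd_mult_iff) blast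
    have not_all: "\<not> (p dvd x \<and> p dvd y \<and> p dvd z)"
    proof (intro notI, elim conjE dvdE)
      fix u v w assume uvw: "x = p * u" "y = p * v" "z = p * w"
      have "p ^ 3 * (4 * (u * v * w)) = p ^ 3 * (u * v + u * w + v * w)"
        using eq unfolding uvw by algebra
      then have "4 * (u * v * w) = u * v + u * w + v * w" using p(1) by simp
      moreover have "0 < u" "0 < v" "0 < w" using uvw xyz p(1) zero_less_mult_pos by blast+
      ultimately show False using no_three_unit_fractions by blast
    qed
    show ?thesis
    \<comment> \<open>Of the eight patterns, three have \<open>p\<close> dividing two denominators,
      three have it dividing one, and \<open>some\<close> and \<open>not_all\<close> exclude the
      remaining two.\<close>
    proof (cases "p dvd x"; cases "p dvd y"; cases "p dvd z")
      assume d: "p dvd x" "p dvd y" "\<not> p dvd z"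
      from type1[OF xyz(3,1,2) d(3,1,2) eqs(2)] show ?thesis by (rule disjI1)
    next
      assume d: "p dvd x" "\<not> p dvd y" "p dvd z"
      from type1[OF xyz(2,1,3) d(2,1,3) eqs(1)] show ?thesis by (rule disjI1)
    next
      assume d: "p dvd x" "\<not> p dvd y" "\<not> p dvd z"
      from type2[OF xyz d eq] show ?thesis by (rule disjI2)
    next
      assume d: "\<not> p dvd x" "p dvd y" "p dvd z"
      from type1[OF xyz d eq] show ?thesis by (rule disjI1)
    next
      assume d: "\<not> p dvd x" "p dvd y" "\<not> p dvd z"
      from type2[OF xyz(2,1,3) d(2,1,3) eqs(1)] show ?thesis by (rule disjI2)
    next
      assume d: "\<not> p dvd x" "\<not> p dvd y" "p dvd z"
      from type2[OF xyz(3,1,2) d(3,1,2) eqs(2)] show ?thesis by (rule disjI2)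
    qed (use some not_all in simp_all)
  qed
  show ?thesis
  proof
    assume ?L
    from forward[OF this] show "?P1a \<or> ?P1b \<or> ?P1c \<or> ?P2a \<or> ?P2b \<or> ?P2c \<or> ?P2d"
      by (simp only: disj_assoc)
  next
    assume "?P1a \<or> ?P1b \<or> ?P1c \<or> ?P2a \<or> ?P2b \<or> ?P2c \<or> ?P2d"
    then show ?L
      by (elim disjE exE conjE)
        (rule egyptian_if_condition_1a[OF p(1)] egyptian_if_condition_1b[OF p(1)]
          egyptian_if_condition_1c[OF p(1)] egyptian_if_condition_2a[OF p(1)]
          egyptian_if_condition_2b[OF p(1)] egyptian_if_condition_2c[OF p(1)]
          egyptian_if_condition_2d[OF p(1)]; assumption)+
  qed
qed

end
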